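(* Let $m,r,n$ be integers with $0\le r\le m$ and $n\ge1$. For $0\le s\le m$ define $$P_{m,s,r}(q)=\frac{\prod_{j=0}^{s}(1-q^{m+1-j})}{(1-q)^{3s-2r}}\sum_{k=0}^{s}\frac{(-1)^{s-k}}{1-q^{m+1-k}}\left[\binom{2m-2r}{k}-\binom{2m-2r}{k-2r-2}\right]\sum_{i=0}^{s-k}\frac{m-k+1}{m-s+1}\binom{m-s+i}{i}\binom{m-k-i}{s-k-i}q^{s-k-i}.$$ Then each $P_{m,s,r}(q)\in\mathbb{Z}[q]$, and $$S_{2m-2r+1,n,r}(q)=\sum_{k=0}^{m}(-1)^kP_{m,k,r}(q)\frac{(1-q^n)^{m+1-k}(1-q^{n+1})^{m+1-k}q^{kn}}{(1-q^{2r+2})(1-q)^{2m-3k}\prod_{i=0}^{k}(1-q^{m+1-i})}.$$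
   Context: $q$ is an indeterminate and $q^{1/2}$ a fixed formal square root of $q$; identities are identities of rational functions in $q^{1/2}$. For integers $m\ge1$, $n\ge1$, $r\ge0$, $$S_{m,n,r}(q)=\sum_{k=1}^{n}\frac{1-q^{(2r+2)k}}{1-q^{2r+2}}\left(\frac{1-q^k}{1-q}\right)^{m-1}q^{\frac{m+2r+1}{2}(n-k)}.$$ Binomial coefficients $\binom{a}{b}$ with integers $a,b$ are taken to be $0$ when $b<0$ or when $0\le a<b$. *)

theory Defs
  imports "HOL-Computational_Algebra.Computational_Algebra"
begin

text \<open>Rational functions in the indeterminate t = q^(1/2): the field rat poly fract.\<close>

definition qh :: "rat poly fract" where
  "qh = to_fract [:0, 1:]"

definition qq :: "rat poly fract" where
  "qq = qh ^ 2"

definition cst :: "rat \<Rightarrow> rat poly fract" where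
  "cst c = to_fract [:c:]"

definition binomZ :: "int \<Rightarrow> int \<Rightarrow> rat" where
  "binomZ a b = (if b < 0 then 0 else (of_int a :: rat) gchoose (nat b))"

definition Sfun :: "nat \<Rightarrow> nat \<Rightarrow> nat \<Rightarrow> rat poly fract" where
  "Sfun m n r = (\<Sum>k = 1..n. (1 - qq ^ ((2*r+2)*k)) / (1 - qq ^ (2*r+2))
       * ((1 - qq ^ k) / (1 - qq)) ^ (m - 1) * qh ^ ((m + 2*r + 1) * (n - k)))"

definition Pfun :: "nat \<Rightarrow> nat \<Rightarrow> nat \<Rightarrow> rat poly fract" where
  "Pfun m s r = (\<Prod>j = 0..s. 1 - qq ^ (m + 1 - j)) / ((1 - qq) powi (3 * int s - 2 * int r))
     * (\<Sum>k = 0..s. (-1) ^ (s - k) / (1 - qq ^ (m + 1 - k))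
         * cst (binomZ (2 * int m - 2 * int r) (int k)
                - binomZ (2 * int m - 2 * int r) (int k - 2 * int r - 2))
         * (\<Sum>i = 0..s - k. of_nat (m - k + 1) / of_nat (m - s + 1)
              * of_nat ((m - s + i) choose i) * of_nat ((m - k - i) choose (s - k - i))
              * qq ^ (s - k - i)))"

text \<open>Membership in Z[q]: a polynomial with integer coefficients in q = t^2.\<close>
definition in_Zq :: "rat poly fract \<Rightarrow> bool" where
  "in_Zq f \<longleftrightarrow> (\<exists>p :: int poly. f = to_fract (pcompose (map_poly of_int p) [:0, 0, 1:]))"

end

theory Submission
  imports Defs
begin

text \<open>
  Since $(1-y^{2r+2})(1-y)^{2m-2r}$ is antipalindromic of degree $2m+2$, summing over $y = q^k$ turns
  the power sum into a combination of the terms $x^j (1-x^d)(1-(qx)^d)/(1-q^d)$ with $x = q^n$ and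
  $d = m+1-j$. A generating function in $d$ expands $(1-x^d)(1-(qx)^d)$ in powers of
  $w = (1-x)(1-qx)$ with coefficients that are polynomials in $q$; collecting powers of $w$ gives
  the identity. For integrality, the coefficients are polynomial after multiplication by
  $\prod_j (1-q^{m+1-j})$, and the identity for all $n$ at once forces them to vanish at $q = 1$ to
  the required order, because $w/(1-q)^2$ takes the infinitely many values $n(n+1)$ there.
\<close>

section \<open>The expansion of $(1 - x^d)(1 - (qx)^d)$ in powers of $(1 - x)(1 - qx)$\<close>

text \<open>The negative binomial series. By Pascal's rule, multiplying by
  \<open>1 - fps_const c * fps_X\<close> lowers \<open>M\<close> by one, which drives the
  induction.\<close>

lemma fps_binomial_series_inverse:
  fixes c :: "'a::field"
  shows "Abs_fps (\<lambda>i. of_nat ((M + i) choose i) * c ^ i) = inverse (1 - fps_const c * fps_X) ^ Suc M"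
proof (induction M)
  case 0
  have "Abs_fps (\<lambda>i. of_nat ((0 + i) choose i) * c ^ i) * (1 - fps_const c * fps_X) = 1"
  proof (rule fps_ext)
    fix n show "(Abs_fps (\<lambda>i. of_nat ((0 + i) choose i) * c ^ i) * (1 - fps_const c * fps_X)) $ n = 1 $ n"
      by (cases n) (simp_all add: right_diff_distrib flip: mult.assoc)
  qed
  then show ?case
    by (metis (no_types, lifting) fps_inverse_unique mult.commute power_Suc0_right One_nat_def)
next
  case (Suc M)
  let ?A = "\<lambda>M. Abs_fps (\<lambda>i. of_nat ((M + i) choose i) * c ^ i)"
  let ?Y = "1 - fps_const c * fps_X"
  have "?A (Suc M) * ?Y = ?A M"
  proof (rule fps_ext)
    fix n show "(?A (Suc M) * ?Y) $ n = ?A M $ n"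
      by (cases n) (simp_all add: algebra_simps)
  qed
  moreover have "?Y * inverse ?Y = 1"
    by (rule inverse_mult_eq_1') simp
  ultimately have "?A (Suc M) = ?A M * inverse ?Y"
    by (simp flip: mult.assoc \<open>?A (Suc M) * ?Y = ?A M\<close>)
  also have "\<dots> = inverse ?Y ^ Suc (Suc M)"
    unfolding Suc.IH power_Suc by (simp only: mult_ac)
  finally show ?case .
qed

text \<open>An integral form of $\frac{M+1+i+l}{M+1}\binom{M+i}{i}\binom{M+l}{l}$, with generating function
  $(1 - YZ)/((1-Y)(1-Z))^{M+2}$ in $Y^i Z^l$.\<close>

definition kcoeff :: "nat \<Rightarrow> nat \<Rightarrow> nat \<Rightarrow> nat" where
  "kcoeff M i l = ((Suc M + i) choose i) * ((M + l) choose l)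
     + (if l = 0 then 0 else ((M + i) choose i) * ((M + l) choose (l - 1)))"

text \<open>Split \<open>Suc M + i + l\<close> as \<open>(Suc M + i) + l\<close>: absorbing each
  part into a binomial coefficient yields the two summands of \<open>kcoeff\<close>. Hence the
  fraction in \<open>Pfun\<close> is a natural number.\<close>

lemma Suc_mult_kcoeff:
  "Suc M * kcoeff M i l = (Suc M + i + l) * (((M + i) choose i) * ((M + l) choose l))"
proof -
  have 1: "Suc M * ((Suc M + i) choose i) = (Suc M + i) * ((M + i) choose i)"
  proof -
    have "Suc M * (Suc (M + i) choose Suc M) = Suc (M + i) * ((M + i) choose M)"
      by (rule Suc_times_binomial)
    then show ?thesis
      using binomial_symmetric[of i "Suc M + i"] binomial_symmetric[of i "M + i"] by simp
  qed
  have 2: "Suc M * ((M + l) choose (l - 1)) = l * ((M + l) choose l)" if "l > 0"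
  proof -
    from that obtain l' where l: "l = Suc l'" by (cases l) auto
    have "Suc l' * (Suc (M + l') choose Suc l') = Suc (M + l') * ((M + l') choose l')"
      by (rule Suc_times_binomial)
    moreover have "Suc M * (Suc (M + l') choose Suc M) = Suc (M + l') * ((M + l') choose M)"
      by (rule Suc_times_binomial)
    ultimately show ?thesis
      using l binomial_symmetric[of l' "Suc M + l'"] binomial_symmetric[of l' "M + l'"] by simp
  qed
  show ?thesis
  proof (cases "l = 0")
    case True
    then show ?thesis using 1 by (simp add: kcoeff_def)
  next
    case False
    have "Suc M * kcoeff M i l = (Suc M * ((Suc M + i) choose i)) * ((M + l) choose l)
        + ((M + i) choose i) * (Suc M * ((M + l) choose (l - 1)))"
      using False by (simp add: kcoeff_def algebra_simps)
    also have "\<dots> = (Suc M + i + l) * (((M + i) choose i) * ((M + l) choose l))"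
      unfolding 1 using 2 False by (simp add: algebra_simps)
    finally show ?thesis .
  qed
qed

text \<open>For \<open>M = m - s\<close> and \<open>u = s - k\<close> this is the inner sum of
  \<open>Pfun\<close>, with its fraction replaced by the integral \<open>kcoeff\<close> so that it
  also makes sense over \<open>int poly\<close>.\<close>

definition kpoly :: "'a::comm_ring_1 \<Rightarrow> nat \<Rightarrow> nat \<Rightarrow> 'a" where
  "kpoly q M u = (\<Sum>i = 0..u. of_nat (kcoeff M i (u - i)) * q ^ (u - i))"

text \<open>The two summands of \<open>kcoeff\<close> contribute
  \<open>1/((1-Y)^(M+2) (1-Z)^(M+1))\<close> and \<open>Z/((1-Y)^(M+1) (1-Z)^(M+2))\<close>; over a
  common denominator the numerator is \<open>(1-Z) + Z(1-Y) = 1 - YZ\<close>.\<close>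

lemma fps_kpoly:
  fixes q x :: "'a::field"
  defines "Y \<equiv> fps_const x * fps_X" and "Z \<equiv> fps_const (q * x) * fps_X"
  shows "Abs_fps (\<lambda>u. kpoly q M u * x ^ u)
    = (1 - Y * Z) * (inverse (1 - Y) * inverse (1 - Z)) ^ Suc (Suc M)"
proof -
  let ?A = "\<lambda>M c. Abs_fps (\<lambda>i. of_nat ((M + i) choose i) * c ^ i)"
  have Y: "inverse (1 - Y) * (1 - Y) = 1" and Z: "inverse (1 - Z) * (1 - Z) = 1"
    by (simp_all add: Y_def Z_def inverse_mult_eq_1)
  have shift: "Abs_fps (\<lambda>l. of_nat (if l = 0 then 0 else ((M + l) choose (l - 1))) * (q * x) ^ l)
      = Z * ?A (Suc M) (q * x)"
  proof (rule fps_ext)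
    fix n show "Abs_fps (\<lambda>l. of_nat (if l = 0 then 0 else ((M + l) choose (l - 1))) * (q * x) ^ l) $ n
      = (Z * ?A (Suc M) (q * x)) $ n"
      by (cases n) (simp_all add: Z_def mult.assoc)
  qed
  have "Abs_fps (\<lambda>u. kpoly q M u * x ^ u) = ?A (Suc M) x * ?A M (q * x)
     + ?A M x * Abs_fps (\<lambda>l. of_nat (if l = 0 then 0 else ((M + l) choose (l - 1))) * (q * x) ^ l)"
  proof (rule fps_ext)
    fix u
    show "Abs_fps (\<lambda>u. kpoly q M u * x ^ u) $ u = (?A (Suc M) x * ?A M (q * x)
     + ?A M x * Abs_fps (\<lambda>l. of_nat (if l = 0 then 0 else ((M + l) choose (l - 1))) * (q * x) ^ l)) $ u"
      unfolding fps_add_nth fps_mult_nth fps_nth_Abs_fps kpoly_def sum_distrib_right sum.distrib[symmetric]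
    proof (rule sum.cong[OF refl])
      fix i assume "i \<in> {0..u}"
      then have "x ^ u = x ^ i * x ^ (u - i)" by (simp flip: power_add)
      then show "of_nat (kcoeff M i (u - i)) * q ^ (u - i) * x ^ u =
         of_nat ((Suc M + i) choose i) * x ^ i * (of_nat ((M + (u - i)) choose (u - i)) * (q * x) ^ (u - i)) +
         of_nat ((M + i) choose i) * x ^ i *
         (of_nat (if u - i = 0 then 0 else ((M + (u - i)) choose (u - i - 1))) * (q * x) ^ (u - i))"
        by (cases "u - i = 0") (simp_all add: kcoeff_def power_mult_distrib algebra_simps)
    qed
  qed
  also have "\<dots> = inverse (1 - Y) ^ Suc (Suc M) * inverse (1 - Z) ^ Suc M
      + inverse (1 - Y) ^ Suc M * (Z * inverse (1 - Z) ^ Suc (Suc M))"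
    unfolding shift fps_binomial_series_inverse Y_def Z_def ..
  also have "\<dots> = inverse (1 - Y) ^ Suc (Suc M) * inverse (1 - Z) ^ Suc M * (inverse (1 - Z) * (1 - Z))
      + inverse (1 - Y) ^ Suc M * (inverse (1 - Y) * (1 - Y)) * (Z * inverse (1 - Z) ^ Suc (Suc M))"
    unfolding Y Z by simp
  also have "\<dots> = (1 - Y * Z) * (inverse (1 - Y) * inverse (1 - Z)) ^ Suc (Suc M)"
    by (simp add: power_mult_distrib algebra_simps)
  finally show ?thesis .
qed

lemma fps_geometric:
  fixes c :: "'a::field"
  shows "Abs_fps (\<lambda>n. c ^ n) * (1 - fps_const c * fps_X) = 1"
proof (rule fps_ext)
  fix n show "(Abs_fps (\<lambda>n. c ^ n) * (1 - fps_const c * fps_X)) $ n = 1 $ n"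
    by (cases n) (simp_all add: right_diff_distrib flip: mult.assoc)
qed

text \<open>Compare coefficients in generating functions over \<open>d\<close>. As
  \<open>V * E = 1 - W * V\<close>, the series \<open>G\<close> is the sum over all \<open>M\<close>
  of \<open>(1 - Y*Z) * W^(M+1) * V^(M+2)\<close>, where \<open>W^(M+1)\<close> multiplies the
  generating function of \<open>kpoly q M\<close>. Truncating to \<open>M < d\<close> gives the
  finite sum \<open>L\<close>.\<close>

lemma kpoly_expansion:
  fixes q x :: "'a::field"
  shows "(1 - x ^ d) * (1 - (q * x) ^ d)
    = (\<Sum>u<d. ((1 - x) * (1 - q * x)) ^ (d - u) * x ^ u * kpoly q (d - u - 1) u)"
proof -
  define w where "w = (1 - x) * (1 - q * x)"
  define Y Z where "Y = fps_const x * fps_X" and "Z = fps_const (q * x) * fps_X"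
  define T where "T = fps_const (q * x * x) * fps_X"
  define V where "V = inverse (1 - Y) * inverse (1 - Z)"
  define W where "W = fps_const w * fps_X"
  define F where "F M = Abs_fps (\<lambda>u. kpoly q M u * x ^ u)" for M
  define L where "L = (\<Sum>M<d. W ^ Suc M * F M)"
  define G where "G = Abs_fps (\<lambda>d. (1 - x ^ d) * (1 - (q * x) ^ d))"
  define E where "E = (1 - fps_X) * (1 - T)"
  have "inverse (1 - Y) * (1 - Y) = 1" "inverse (1 - Z) * (1 - Z) = 1"
    by (simp_all add: Y_def Z_def inverse_mult_eq_1)
  moreover have "V * ((1 - Y) * (1 - Z)) = (inverse (1 - Y) * (1 - Y)) * (inverse (1 - Z) * (1 - Z))"
    by (simp only: V_def ac_simps)
  ultimately have V: "V * ((1 - Y) * (1 - Z)) = 1" by simp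
  have YZ: "Y * Z = fps_X * T"
  proof -
    have "Y * Z = fps_X * (fps_const x * fps_const (q * x) * fps_X)"
      unfolding Y_def Z_def by (simp only: mult_ac)
    also have "fps_const x * fps_const (q * x) = fps_const (q * x * x)"
      by (simp add: mult_ac)
    finally show ?thesis unfolding T_def .
  qed
  \<comment> \<open>This is \<open>1 + q x^2 = x + q x + w\<close> times \<open>fps_X\<close>; the
    particular choice of \<open>w\<close> enters here.\<close>
  have "fps_X + T = Y + Z + W"
  proof -
    have "fps_X + T = (fps_const 1 + fps_const (q * x * x)) * fps_X"
      unfolding T_def distrib_right fps_const_1_eq_1 by simp
    also have "\<dots> = fps_const (1 + q * x * x) * fps_X" by (simp only: fps_const_add)
    also have "1 + q * x * x = x + q * x + w" by (simp add: w_def algebra_simps)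
    also have "fps_const (x + q * x + w) * fps_X = Y + Z + W"
      by (simp only: Y_def Z_def W_def distrib_right flip: fps_const_add)
    finally show ?thesis .
  qed
  with YZ have E: "E = (1 - Y) * (1 - Z) - W"
    unfolding E_def by algebra
  have Ldef: "L = (\<Sum>M<d. W ^ Suc M * ((1 - Y * Z) * V ^ Suc (Suc M)))"
    by (simp add: L_def F_def fps_kpoly Y_def Z_def V_def)
  \<comment> \<open>Since \<open>V * E = 1 - W * V\<close>, the sum telescopes.\<close>
  have "L * E = (1 - Y * Z) * (\<Sum>M<d. (W * V) ^ Suc M - (W * V) ^ Suc (Suc M))"
    unfolding Ldef sum_distrib_left sum_distrib_right
  proof (rule sum.cong[OF refl])
    fix M
    have "W ^ Suc M * ((1 - Y * Z) * V ^ Suc (Suc M)) * E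
      = (1 - Y * Z) * ((W * V) ^ Suc M * (V * ((1 - Y) * (1 - Z))) - (W * V) ^ Suc (Suc M))"
    proof -
      have "W ^ Suc M * ((1 - Y * Z) * V ^ Suc (Suc M)) * E = (1 - Y * Z) * ((W * V) ^ Suc M * (V * E))"
        by (simp add: power_mult_distrib mult_ac)
      also have "(W * V) ^ Suc M * (V * E)
        = (W * V) ^ Suc M * (V * ((1 - Y) * (1 - Z))) - (W * V) ^ Suc (Suc M)"
        unfolding E power_Suc by algebra
      finally show ?thesis .
    qed
    then show "W ^ Suc M * ((1 - Y * Z) * V ^ Suc (Suc M)) * E
      = (1 - Y * Z) * ((W * V) ^ Suc M - (W * V) ^ Suc (Suc M))" unfolding V by simp
  qed
  also have "(\<Sum>M<d. (W * V) ^ Suc M - (W * V) ^ Suc (Suc M)) = W * V - (W * V) ^ Suc d"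
    by (subst sum_lessThan_telescope') simp
  finally have LE: "L * E = (1 - Y * Z) * (W * V - (W * V) ^ Suc d)" .
  have GE: "G * E = (1 - Y * Z) * (W * V)"
  proof -
    let ?g = "\<lambda>c::'a. Abs_fps (\<lambda>n. c ^ n)"
    \<comment> \<open>Multiplying out gives four geometric series, with ratios \<open>1\<close>,
      \<open>q x^2\<close>, \<open>x\<close> and \<open>q x\<close>.\<close>
    have G: "G = ?g 1 + ?g (q * x * x) - ?g x - ?g (q * x)"
      by (rule fps_ext) (simp add: G_def algebra_simps power_mult_distrib)
    have g1: "?g 1 * (1 - fps_X) = 1" and gT: "?g (q * x * x) * (1 - T) = 1"
      and gY: "?g x * (1 - Y) = 1" and gZ: "?g (q * x) * (1 - Z) = 1"
      using fps_geometric[of 1] fps_geometric[of "q * x * x"] fps_geometric[of x] fps_geometric[of "q * x"]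
      by (simp_all add: T_def Y_def Z_def)
    have gV: "?g x * ?g (q * x) = V"
    proof -
      have "?g x = inverse (1 - Y)" "?g (q * x) = inverse (1 - Z)"
        using gY gZ by (metis fps_inverse_unique mult.commute)+
      then show ?thesis by (simp add: V_def)
    qed
    have "(?g 1 + ?g (q * x * x)) * E = (?g 1 * (1 - fps_X)) * (1 - T) + (?g (q * x * x) * (1 - T)) * (1 - fps_X)"
      unfolding E_def by algebra
    also have "\<dots> = E + (1 - Y * Z)" unfolding g1 gT E_def YZ by algebra
    finally have 1: "(?g 1 + ?g (q * x * x)) * E = E + (1 - Y * Z)" .
    have "?g x + ?g (q * x) = ?g x * (?g (q * x) * (1 - Z)) + ?g (q * x) * (?g x * (1 - Y))"
      unfolding gY gZ by simp
    also have "\<dots> = V * ((1 - Y) * (1 - Z)) + V * (1 - Y * Z)"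
      unfolding gV[symmetric] by algebra
    finally have 2: "?g x + ?g (q * x) = 1 + V * (1 - Y * Z)" unfolding V .
    have "G * E = (?g 1 + ?g (q * x * x)) * E - (?g x + ?g (q * x)) * E"
      unfolding G by algebra
    also have "\<dots> = (1 - Y * Z) * (1 - V * E)" unfolding 1 2 by algebra
    also have "1 - V * E = W * V" using V unfolding E by algebra
    finally show ?thesis .
  qed
  have "(G - L) * E = (1 - Y * Z) * (W * V) ^ Suc d"
    unfolding left_diff_distrib LE GE by algebra
  moreover have "E * inverse E = 1"
    by (rule inverse_mult_eq_1') (simp add: E_def T_def)
  ultimately have "G - L = (1 - Y * Z) * (W * V) ^ Suc d * inverse E"
    by (metis mult.assoc mult.right_neutral)
  then have "G - L = fps_X ^ Suc d * (fps_const w ^ Suc d * ((1 - Y * Z) * V ^ Suc d * inverse E))"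
    by (simp add: W_def power_mult_distrib mult_ac)
  \<comment> \<open>The error carries \<open>W ^ Suc d\<close>, hence \<open>fps_X ^ Suc d\<close>,
    and cannot reach coefficient \<open>d\<close>.\<close>
  then have "(G - L) $ d = 0"
    by (simp only: fps_X_power_mult_nth) simp
  then have "G $ d = L $ d" by simp
  also have "L $ d = (\<Sum>M<d. w ^ Suc M * (kpoly q M (d - Suc M) * x ^ (d - Suc M)))"
  proof -
    have "(W ^ Suc M * F M) $ d = w ^ Suc M * (kpoly q M (d - Suc M) * x ^ (d - Suc M))" if "M < d" for M
    proof -
      have "W ^ Suc M * F M = fps_X ^ Suc M * (fps_const (w ^ Suc M) * F M)"
        by (simp only: W_def power_mult_distrib fps_const_power mult_ac)
      then show ?thesis using that
        by (simp only: fps_X_power_mult_nth) (simp add: F_def)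
    qed
    then show ?thesis by (simp add: L_def fps_sum_nth)
  qed
  also have "\<dots> = (\<Sum>u<d. w ^ (d - u) * x ^ u * kpoly q (d - u - 1) u)"
    by (rule sum.reindex_bij_witness[of _ "\<lambda>u. d - Suc u" "\<lambda>u. d - Suc u"])
      (auto simp: Suc_diff_Suc mult.commute mult.left_commute)
  finally show ?thesis by (simp add: G_def w_def)
qed

section \<open>Expansion of the power sum\<close>

text \<open>Up to the sign \<open>(-1)^j\<close>, the coefficients of
  \<open>(1 - y^R) (1 - y)^N\<close> for even \<open>R\<close>. The case split is there because
  truncated subtraction would turn a negative lower index into \<open>0\<close>, where the binomial
  coefficient is \<open>1\<close>.\<close>

definition acoeff :: "nat \<Rightarrow> nat \<Rightarrow> nat \<Rightarrow> int" where
  "acoeff N R j = int (N choose j) - (if R \<le> j then int (N choose (j - R)) else 0)"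

text \<open>Reflecting \<open>j\<close> exchanges the two binomial coefficients, by the symmetry of
  row \<open>N\<close>.\<close>

lemma acoeff_antisym:
  assumes "j \<le> N + R"
  shows "acoeff N R (N + R - j) = - acoeff N R j"
proof -
  have 1: "int (N choose (N + R - j)) = (if R \<le> j then int (N choose (j - R)) else 0)"
    using assms binomial_symmetric[of "j - R" N] by (auto simp: binomial_eq_0)
  have 2: "(if R \<le> N + R - j then int (N choose (N + R - j - R)) else 0) = int (N choose j)"
  proof (cases "j \<le> N")
    case True
    then show ?thesis using binomial_symmetric[of j N] by simp
  qed (use assms in \<open>simp add: binomial_eq_0\<close>)
  show ?thesis unfolding acoeff_def 1 2 by simp
qed

text \<open>Evenness of \<open>R\<close> gives \<open>y ^ R = (- y) ^ R\<close>, so both parts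
  expand in powers of \<open>- y\<close>.\<close>

lemma acoeff_expansion:
  fixes y :: "'a::comm_ring_1"
  assumes "even R"
  shows "(1 - y ^ R) * (1 - y) ^ N = (\<Sum>j\<le>N + R. of_int (acoeff N R j) * (- y) ^ j)"
proof -
  have B: "(1 - y) ^ N = (\<Sum>j\<le>N. of_nat (N choose j) * (- y) ^ j)"
    using binomial_ring[of "- y" 1 N] by simp
  have 1: "(1 - y) ^ N = (\<Sum>j\<le>N + R. of_nat (N choose j) * (- y) ^ j)"
    unfolding B by (rule sum.mono_neutral_left) (auto simp: binomial_eq_0)
  have "y ^ R * (1 - y) ^ N = (\<Sum>j\<le>N. of_nat (N choose j) * (- y) ^ (j + R))"
    unfolding B using assms by (simp add: sum_distrib_left power_add mult_ac)
  also have "\<dots> = (\<Sum>j\<in>{R..N + R}. of_nat (N choose (j - R)) * (- y) ^ j)"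
    by (rule sum.reindex_bij_witness[of _ "\<lambda>j. j - R" "\<lambda>j. j + R"]) auto
  also have "\<dots> = (\<Sum>j\<le>N + R. of_int (if R \<le> j then int (N choose (j - R)) else 0) * (- y) ^ j)"
    by (rule sum.mono_neutral_cong_left) auto
  finally have 2: "y ^ R * (1 - y) ^ N = \<dots>" .
  have "(1 - y ^ R) * (1 - y) ^ N = (1 - y) ^ N - y ^ R * (1 - y) ^ N"
    by (simp add: left_diff_distrib)
  also have "\<dots> = (\<Sum>j\<le>N + R. of_int (acoeff N R j) * (- y) ^ j)"
    unfolding 2 unfolding 1 sum_subtractf[symmetric]
    by (rule sum.cong[OF refl]) (simp add: acoeff_def left_diff_distrib)
  finally show ?thesis .
qed

lemma sum_atMost_fold_symmetric:
  fixes g :: "nat \<Rightarrow> 'a::comm_monoid_add"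
  shows "(\<Sum>j\<le>2 * m + 2. g j) = (\<Sum>j\<le>m. g j + g (2 * m + 2 - j)) + g (m + 1)"
proof -
  have "{..2 * m + 2} = {..m} \<union> {m + 1} \<union> {m + 2..2 * m + 2}" by auto
  then have "(\<Sum>j\<le>2 * m + 2. g j) = (\<Sum>j\<le>m. g j) + g (m + 1) + (\<Sum>j = m + 2..2 * m + 2. g j)"
    by (simp only:) (subst sum.union_disjoint; simp add: add.commute)+
  also have "(\<Sum>j = m + 2..2 * m + 2. g j) = (\<Sum>j\<le>m. g (2 * m + 2 - j))"
    by (rule sum.reindex_bij_witness[of _ "\<lambda>j. 2 * m + 2 - j" "\<lambda>j. 2 * m + 2 - j"]) auto
  finally show ?thesis by (simp add: sum.distrib ac_simps)
qed

text \<open>Antisymmetry pairs \<open>j\<close> with \<open>2 * m + 2 - j\<close>, which has the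
  same parity. The middle coefficient, at \<open>m + 1\<close>, equals its own negative and
  vanishes.\<close>

lemma acoeff_expansion_folded:
  fixes y :: "'a::comm_ring_1"
  assumes "even R" "N + R = 2 * m + 2"
  shows "(1 - y ^ R) * (1 - y) ^ N
    = (\<Sum>j\<le>m. of_int ((-1) ^ j * acoeff N R j) * (y ^ j - y ^ (2 * m + 2 - j)))"
proof -
  have "acoeff N R (m + 1) = 0"
    using acoeff_antisym[of "m + 1" N R] assms(2) by simp
  moreover have "of_int (acoeff N R j) * (- y) ^ j + of_int (acoeff N R (2 * m + 2 - j)) * (- y) ^ (2 * m + 2 - j)
     = of_int ((-1) ^ j * acoeff N R j) * (y ^ j - y ^ (2 * m + 2 - j))" if "j \<le> m" for j
  proof -
    have "acoeff N R (2 * m + 2 - j) = - acoeff N R j"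
      using acoeff_antisym[of j N R] assms(2) that by simp
    moreover have "(- y) ^ j = (-1) ^ j * y ^ j" by (rule power_minus)
    moreover have "(- y) ^ (2 * m + 2 - j) = (-1) ^ j * y ^ (2 * m + 2 - j)"
      using that by (subst power_minus) (simp add: minus_one_power_iff)
    ultimately show ?thesis by (simp add: algebra_simps)
  qed
  ultimately show ?thesis
    unfolding acoeff_expansion[OF assms(1)] assms(2) sum_atMost_fold_symmetric by simp
qed

lemma geometric_difference_sum:
  fixes z :: "'a::comm_ring_1"
  shows "(1 - z) * (\<Sum>k = 1..n. z ^ (n - k) - z ^ (n + k)) = (1 - z ^ n) * (1 - z ^ (n + 1))"
proof -
  have "(\<Sum>k = 1..n. z ^ (n - k) - z ^ (n + k)) = (1 - z ^ (n + 1)) * (\<Sum>k<n. z ^ k)"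
  proof -
    have "(\<Sum>k = 1..n. z ^ (n - k)) = (\<Sum>k<n. z ^ k)"
      by (rule sum.reindex_bij_witness[of _ "\<lambda>k. n - k" "\<lambda>k. n - k"]) auto
    moreover have "(\<Sum>k = 1..n. z ^ (n + k)) = (\<Sum>k<n. z ^ (n + 1) * z ^ k)"
      by (rule sum.reindex_bij_witness[of _ "\<lambda>k. k + 1" "\<lambda>k. k - 1"])
        (auto simp flip: power_add power_Suc)
    ultimately show ?thesis
      by (simp add: sum_subtractf left_diff_distrib sum_distrib_left)
  qed
  then show ?thesis
    by (simp only: one_diff_power_eq[of z n] mult_ac)
qed

text \<open>Put \<open>y = q ^ k\<close> in the folded expansion and exchange the sums; for fixed
  \<open>j\<close> the sum over \<open>k\<close> is geometric in \<open>z = q ^ (m + 1 - j)\<close>.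
  The hypothesis on \<open>q\<close> keeps \<open>1 - z\<close> invertible.\<close>

lemma power_sum_expansion:
  fixes q :: "'a::field"
  assumes "even R" "N + R = 2 * m + 2" and q: "\<And>d. d > 0 \<Longrightarrow> q ^ d \<noteq> 1"
  shows "(\<Sum>k = 1..n. (1 - q ^ (R * k)) * (1 - q ^ k) ^ N * q ^ ((m + 1) * (n - k)))
    = (\<Sum>j\<le>m. of_int ((-1) ^ j * acoeff N R j) / (1 - q ^ (m + 1 - j)) * q ^ (j * n)
        * ((1 - (q ^ n) ^ (m + 1 - j)) * (1 - (q * q ^ n) ^ (m + 1 - j))))"
proof -
  have "(\<Sum>k = 1..n. (1 - q ^ (R * k)) * (1 - q ^ k) ^ N * q ^ ((m + 1) * (n - k)))
    = (\<Sum>k = 1..n. \<Sum>j\<le>m. of_int ((-1) ^ j * acoeff N R j)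
         * (((q ^ k) ^ j - (q ^ k) ^ (2 * m + 2 - j)) * q ^ ((m + 1) * (n - k))))"
  proof (rule sum.cong[OF refl])
    fix k
    have "(1 - q ^ (R * k)) * (1 - q ^ k) ^ N = (1 - (q ^ k) ^ R) * (1 - q ^ k) ^ N"
      by (simp add: mult.commute flip: power_mult)
    then show "(1 - q ^ (R * k)) * (1 - q ^ k) ^ N * q ^ ((m + 1) * (n - k))
      = (\<Sum>j\<le>m. of_int ((-1) ^ j * acoeff N R j)
         * (((q ^ k) ^ j - (q ^ k) ^ (2 * m + 2 - j)) * q ^ ((m + 1) * (n - k))))"
      unfolding acoeff_expansion_folded[OF assms(1,2)] sum_distrib_right
      by (simp only: sum_distrib_right mult.assoc)
  qed
  also have "\<dots> = (\<Sum>j\<le>m. of_int ((-1) ^ j * acoeff N R j)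
         * (\<Sum>k = 1..n. ((q ^ k) ^ j - (q ^ k) ^ (2 * m + 2 - j)) * q ^ ((m + 1) * (n - k))))"
    by (subst sum.swap) (simp add: sum_distrib_left)
  also have "\<dots> = (\<Sum>j\<le>m. of_int ((-1) ^ j * acoeff N R j) / (1 - q ^ (m + 1 - j)) * q ^ (j * n)
        * ((1 - (q ^ n) ^ (m + 1 - j)) * (1 - (q * q ^ n) ^ (m + 1 - j))))"
  proof (rule sum.cong[OF refl])
    fix j assume j: "j \<in> {..m}"
    define d where "d = m + 1 - j"
    have d: "m + 1 = j + d" "d > 0" "2 * m + 2 - j = j + 2 * d" using j by (auto simp: d_def)
    define z where "z = q ^ d"
    \<comment> \<open>With \<open>m + 1 = j + d\<close> the exponents are
      \<open>k j + (m+1)(n-k) = j n + d (n-k)\<close> and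
      \<open>k (j+2d) + (m+1)(n-k) = j n + d (n+k)\<close>.\<close>
    have "((q ^ k) ^ j - (q ^ k) ^ (2 * m + 2 - j)) * q ^ ((m + 1) * (n - k))
        = q ^ (j * n) * (z ^ (n - k) - z ^ (n + k))" if k: "k \<in> {1..n}" for k
    proof -
      from k obtain l where n: "n = k + l" by (metis atLeastAtMost_iff le_Suc_ex)
      show ?thesis unfolding d z_def n
        by (simp add: algebra_simps mult_2_right flip: power_mult power_add)
    qed
    then have "(\<Sum>k = 1..n. ((q ^ k) ^ j - (q ^ k) ^ (2 * m + 2 - j)) * q ^ ((m + 1) * (n - k)))
        = q ^ (j * n) * (\<Sum>k = 1..n. z ^ (n - k) - z ^ (n + k))"
      by (simp add: sum_distrib_left)
    moreover have "(\<Sum>k = 1..n. z ^ (n - k) - z ^ (n + k)) = (1 - z ^ n) * (1 - z ^ (n + 1)) / (1 - z)"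
      using q[OF d(2)] unfolding geometric_difference_sum[symmetric] z_def by simp
    moreover have "z ^ n = (q ^ n) ^ d" "z ^ (n + 1) = (q * q ^ n) ^ d"
      by (simp_all add: z_def mult_ac flip: power_mult power_Suc)
    ultimately show "of_int ((-1) ^ j * acoeff N R j)
         * (\<Sum>k = 1..n. ((q ^ k) ^ j - (q ^ k) ^ (2 * m + 2 - j)) * q ^ ((m + 1) * (n - k)))
       = of_int ((-1) ^ j * acoeff N R j) / (1 - q ^ (m + 1 - j)) * q ^ (j * n)
        * ((1 - (q ^ n) ^ (m + 1 - j)) * (1 - (q * q ^ n) ^ (m + 1 - j)))"
      by (simp add: z_def d_def)
  qed
  finally show ?thesis .
qed

text \<open>\<open>Pfun\<close> without its prefactor, over any field and for general
  \<open>N\<close> and \<open>R\<close>.\<close>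

definition tcoeff :: "'a::field \<Rightarrow> nat \<Rightarrow> nat \<Rightarrow> nat \<Rightarrow> nat \<Rightarrow> 'a" where
  "tcoeff q m N R s = (\<Sum>k = 0..s. (-1) ^ (s - k) / (1 - q ^ (m + 1 - k))
      * of_int (acoeff N R k) * kpoly q (m - s) (s - k))"

text \<open>Expand each term by \<open>kpoly_expansion\<close> with \<open>x = q ^ n\<close>,
  \<open>d = m + 1 - j\<close>, and put \<open>s = j + u\<close>: the exponent of \<open>w\<close>
  becomes \<open>d - u = m + 1 - s\<close>, and \<open>q ^ (j * n) * x ^ u = q ^ (s * n)\<close>.
  Both depend on \<open>s\<close> only.\<close>

lemma power_sum_eq_tcoeff_sum:
  fixes q :: "'a::field"
  assumes "even R" "N + R = 2 * m + 2" and q: "\<And>d. d > 0 \<Longrightarrow> q ^ d \<noteq> 1"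
  shows "(\<Sum>k = 1..n. (1 - q ^ (R * k)) * (1 - q ^ k) ^ N * q ^ ((m + 1) * (n - k)))
    = (\<Sum>s = 0..m. (-1) ^ s * tcoeff q m N R s
        * ((1 - q ^ n) * (1 - q ^ (n + 1))) ^ (m + 1 - s) * q ^ (s * n))"
proof -
  define w where "w = (1 - q ^ n) * (1 - q ^ (n + 1))"
  define h where "h j s = (-1) ^ s * ((-1) ^ (s - j) / (1 - q ^ (m + 1 - j))
      * of_int (acoeff N R j) * kpoly q (m - s) (s - j)) * w ^ (m + 1 - s) * q ^ (s * n)" for j s
  have "of_int ((-1) ^ j * acoeff N R j) / (1 - q ^ (m + 1 - j)) * q ^ (j * n)
        * ((1 - (q ^ n) ^ (m + 1 - j)) * (1 - (q * q ^ n) ^ (m + 1 - j)))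
      = (\<Sum>s = j..m. h j s)" if "j \<le> m" for j
  proof -
    have sgn: "(-1::'a) ^ (j + u) * (-1) ^ u = (-1) ^ j" for u
      by (simp add: power_add minus_one_power_iff)
    have "(1 - (q ^ n) ^ (m + 1 - j)) * (1 - (q * q ^ n) ^ (m + 1 - j))
       = (\<Sum>u<m + 1 - j. w ^ (m + 1 - j - u) * (q ^ n) ^ u * kpoly q (m + 1 - j - u - 1) u)"
      unfolding w_def kpoly_expansion by simp
    also have "\<dots> = (\<Sum>s = j..m. w ^ (m + 1 - s) * (q ^ n) ^ (s - j) * kpoly q (m - s) (s - j))"
      using that by (intro sum.reindex_bij_witness[of _ "\<lambda>s. s - j" "\<lambda>u. u + j"]) (auto simp: add.commute)
    finally have "of_int ((-1) ^ j * acoeff N R j) / (1 - q ^ (m + 1 - j)) * q ^ (j * n)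
        * ((1 - (q ^ n) ^ (m + 1 - j)) * (1 - (q * q ^ n) ^ (m + 1 - j)))
      = (\<Sum>s = j..m. of_int ((-1) ^ j * acoeff N R j) / (1 - q ^ (m + 1 - j)) * q ^ (j * n) * 
           (w ^ (m + 1 - s) * (q ^ n) ^ (s - j) * kpoly q (m - s) (s - j)))"
      by (simp add: sum_distrib_left)
    also have "\<dots> = (\<Sum>s = j..m. h j s)"
    proof (rule sum.cong[OF refl])
      fix s assume "s \<in> {j..m}"
      then obtain u where s: "s = j + u" by (metis atLeastAtMost_iff le_Suc_ex)
      show "of_int ((-1) ^ j * acoeff N R j) / (1 - q ^ (m + 1 - j)) * q ^ (j * n) * 
           (w ^ (m + 1 - s) * (q ^ n) ^ (s - j) * kpoly q (m - s) (s - j)) = h j s"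
      proof -
        have 1: "q ^ (s * n) = q ^ (j * n) * (q ^ n) ^ u"
          by (simp add: s distrib_right power_add mult.commute[of _ n] power_mult)
        have 2: "of_int ((-1) ^ j * acoeff N R j) = (-1::'a) ^ s * (-1) ^ u * of_int (acoeff N R j)"
          by (simp add: s sgn)
        have 3: "s - j = u" by (simp add: s)
        have 4: "x * y * a / D * b * (c * z * K) = x * (y / D * a * K) * c * (b * z)"
          for x y a D b c z K :: 'a by simp
        show ?thesis unfolding h_def 1 2 3 by (rule 4)
      qed
    qed
    finally show ?thesis .
  qed
  note inner = this
  have "(\<Sum>k = 1..n. (1 - q ^ (R * k)) * (1 - q ^ k) ^ N * q ^ ((m + 1) * (n - k)))
    = (\<Sum>j\<le>m. of_int ((-1) ^ j * acoeff N R j) / (1 - q ^ (m + 1 - j)) * q ^ (j * n)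
        * ((1 - (q ^ n) ^ (m + 1 - j)) * (1 - (q * q ^ n) ^ (m + 1 - j))))"
    using assms by (rule power_sum_expansion)
  also have "\<dots> = (\<Sum>j\<le>m. \<Sum>s = j..m. h j s)"
    by (rule sum.cong[OF refl], rule inner) simp
  also have "\<dots> = (\<Sum>s = 0..m. \<Sum>j = 0..s. h j s)"
  proof -
    have "(\<Sum>j\<le>m. \<Sum>s = j..m. h j s) = (\<Sum>j\<in>{0..m}. \<Sum>s\<in>{s. s \<in> {0..m} \<and> j \<le> s}. h j s)"
      by (intro sum.cong) auto
    also have "\<dots> = (\<Sum>s\<in>{0..m}. \<Sum>j\<in>{j. j \<in> {0..m} \<and> j \<le> s}. h j s)"
      by (rule sum.swap_restrict) auto
    also have "\<dots> = (\<Sum>s = 0..m. \<Sum>j = 0..s. h j s)"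
      by (intro sum.cong) auto
    finally show ?thesis .
  qed
  also have "\<dots> = (\<Sum>s = 0..m. (-1) ^ s * tcoeff q m N R s * w ^ (m + 1 - s) * q ^ (s * n))"
    by (simp only: h_def tcoeff_def sum_distrib_left sum_distrib_right)
  finally show ?thesis unfolding w_def .
qed

section \<open>Divisibility by powers of $1 - q$\<close>

abbreviation (input) X :: "int poly" where "X \<equiv> [:0, 1:]"

lemma one_minus_X_dvd_iff: "1 - X dvd p \<longleftrightarrow> poly p 1 = 0"
proof -
  have "1 - X = - [:-1, 1:]" by (simp add: one_pCons)
  then show ?thesis by (simp only: minus_dvd_iff poly_eq_0_iff_dvd)
qed

lemma one_minus_X_power_neq_0: "(1 - X) ^ n \<noteq> 0"
  by (rule power_not_zero) (simp add: one_pCons)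

text \<open>Evaluation at 1 detects a factor \<open>1 - X\<close>. As \<open>r\<close> does not
  vanish there, every such factor comes from \<open>p\<close>; they are split off one at a
  time.\<close>

lemma one_minus_X_power_dvd_cancel:
  assumes "(1 - X) ^ K dvd p * r" "poly r 1 \<noteq> 0"
  shows "(1 - X) ^ K dvd p"
  using assms(1)
proof (induction K arbitrary: p)
  case (Suc K)
  then have "1 - X dvd p * r" by (metis dvd_power dvd_trans zero_less_Suc)
  then have "1 - X dvd p" using assms(2) by (simp only: one_minus_X_dvd_iff) simp
  then obtain p' where p: "p = (1 - X) * p'" by (rule dvdE)
  have "1 - X \<noteq> 0" using one_minus_X_power_neq_0[of 1] by (simp only: power_one_right not_False_eq_True)
  moreover have "(1 - X) * (1 - X) ^ K dvd (1 - X) * (p' * r)"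
    using Suc.prems by (simp only: p power_Suc mult.assoc)
  ultimately have "(1 - X) ^ K dvd p' * r" by (simp only: dvd_mult_cancel_left) simp
  from Suc.IH[OF this] show ?case unfolding p power_Suc by (rule mult_dvd_mono[OF dvd_refl])
qed simp

text \<open>Once all the \<open>U s\<close> are divided by a common power of \<open>1 - X\<close>, evaluation at 1 gives a
  polynomial with the infinitely many roots \<open>c n\<close>, so a further factor splits off.\<close>

lemma vandermonde_dvd:
  fixes U :: "nat \<Rightarrow> int poly" and g :: "nat \<Rightarrow> nat \<Rightarrow> int poly" and c :: "nat \<Rightarrow> int"
  assumes dvd: "\<And>n. (1 - X) ^ K dvd (\<Sum>s = 0..m. g n s * U s)"
    and g: "\<And>n s. s \<le> m \<Longrightarrow> poly (g n s) 1 = e s * c n ^ (m + 1 - s)"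
    and e: "\<And>s. s \<le> m \<Longrightarrow> e s \<noteq> 0"
    and "inj c" and "s \<le> m"
  shows "(1 - X) ^ K dvd U s"
proof -
  have "\<forall>s \<le> m. (1 - X) ^ K dvd U s" using dvd
  proof (induction K)
    case (Suc K)
    have "(1 - X) ^ K dvd (\<Sum>s = 0..m. g n s * U s)" for n
      using Suc.prems[of n] unfolding power_Suc by (rule dvd_mult_right)
    from Suc.IH[OF this] have "\<forall>s. \<exists>V. s \<le> m \<longrightarrow> U s = (1 - X) ^ K * V"
      by (meson dvdE)
    then obtain V where V: "U s = (1 - X) ^ K * V s" if "s \<le> m" for s
      by metis
    define P where "P = (\<Sum>s = 0..m. monom (e s * poly (V s) 1) (m + 1 - s))"
    have "poly P (c n) = 0" for n
    proof -
      have "(\<Sum>s = 0..m. g n s * U s) = (1 - X) ^ K * (\<Sum>s = 0..m. g n s * V s)"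
        unfolding sum_distrib_left by (rule sum.cong) (simp_all add: V mult.left_commute)
      with Suc.prems[of n] have "(1 - X) ^ K * (1 - X) dvd (1 - X) ^ K * (\<Sum>s = 0..m. g n s * V s)"
        by (simp only: power_Suc2)
      moreover have "(1 - X) ^ K \<noteq> 0" by (rule one_minus_X_power_neq_0)
      ultimately have "1 - X dvd (\<Sum>s = 0..m. g n s * V s)"
        by (simp only: dvd_mult_cancel_left) simp
      then have "(\<Sum>s = 0..m. poly (g n s) 1 * poly (V s) 1) = 0"
        by (simp only: one_minus_X_dvd_iff poly_sum poly_mult)
      also have "(\<Sum>s = 0..m. poly (g n s) 1 * poly (V s) 1) = poly P (c n)"
        unfolding P_def poly_sum by (rule sum.cong) (simp_all add: g poly_monom)
      finally show ?thesis .
    qed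
    then have "range c \<subseteq> {x. poly P x = 0}" by auto
    moreover have "infinite (range c)" using \<open>inj c\<close> by (rule range_inj_infinite)
    ultimately have "P = 0" using poly_roots_finite finite_subset by blast
    show ?case
    proof (intro allI impI)
      fix s assume s: "s \<le> m"
      \<comment> \<open>The exponents \<open>m + 1 - t\<close> with \<open>t <= m\<close> are
        distinct, so this coefficient isolates the summand \<open>t = s\<close>.\<close>
      have "0 = coeff P (m + 1 - s)" using \<open>P = 0\<close> by simp
      also have "\<dots> = (\<Sum>t = 0..m. if t = s then e s * poly (V s) 1 else 0)"
        unfolding P_def coeff_sum using s by (intro sum.cong) auto
      also have "\<dots> = e s * poly (V s) 1" using s by simp
      finally have "1 - X dvd V s" using e[OF s] unfolding one_minus_X_dvd_iff by simp
      then show "(1 - X) ^ Suc K dvd U s"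
        unfolding V[OF s] power_Suc2 by (rule mult_dvd_mono[OF dvd_refl])
    qed
  qed simp
  with \<open>s \<le> m\<close> show ?thesis by blast
qed

section \<open>The embedding of $\mathbb{Z}[q]$\<close>

text \<open>The substitution in \<open>in_Zq\<close> as a function: an injective ring homomorphism
  sending \<open>X\<close> to \<open>qq\<close>, so that divisibility can be studied in
  \<open>int poly\<close>.\<close>

definition zemb :: "int poly \<Rightarrow> rat poly fract" where
  "zemb p = to_fract (pcompose (map_poly of_int p) [:0, 0, 1:])"

lemma map_poly_of_int_add: "map_poly of_int (p + q) = (map_poly of_int p + map_poly of_int q :: rat poly)"
  by (rule poly_eqI) (simp add: coeff_map_poly)

lemma map_poly_of_int_mult: "map_poly of_int (p * q) = (map_poly of_int p * map_poly of_int q :: rat poly)"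
  by (rule poly_eqI) (simp add: coeff_map_poly coeff_mult)

lemma zemb_0 [simp]: "zemb 0 = 0"
  by (simp add: zemb_def)

lemma zemb_1 [simp]: "zemb 1 = 1"
  by (simp add: zemb_def map_poly_1' pcompose_1)

lemma zemb_add [simp]: "zemb (p + q) = zemb p + zemb q"
  by (simp add: zemb_def map_poly_of_int_add pcompose_add)

lemma zemb_mult [simp]: "zemb (p * q) = zemb p * zemb q"
  by (simp add: zemb_def map_poly_of_int_mult pcompose_mult)

lemma zemb_uminus [simp]: "zemb (- p) = - zemb p"
  using zemb_add[of p "- p"] by (simp add: eq_neg_iff_add_eq_0 add.commute del: zemb_add)

lemma zemb_diff [simp]: "zemb (p - q) = zemb p - zemb q"
  using zemb_add[of p "- q"] by simp

lemma zemb_power [simp]: "zemb (p ^ n) = zemb p ^ n"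
  by (induction n) simp_all

lemma zemb_sum [simp]: "zemb (sum f A) = (\<Sum>x\<in>A. zemb (f x))"
  by (induction A rule: infinite_finite_induct) simp_all

lemma zemb_prod [simp]: "zemb (prod f A) = (\<Prod>x\<in>A. zemb (f x))"
  by (induction A rule: infinite_finite_induct) simp_all

lemma zemb_of_nat [simp]: "zemb (of_nat n) = of_nat n"
  by (induction n) simp_all

lemma zemb_of_int [simp]: "zemb (of_int n) = of_int n"
  by (cases n) simp_all

lemma zemb_X [simp]: "zemb X = qq"
  by (simp add: zemb_def map_poly_pCons pcompose_pCons qq_def qh_def power2_eq_square flip: to_fract_mult)

text \<open>Injectivity: substituting the nonconstant polynomial \<open>t^2\<close> annihilates no
  nonzero polynomial.\<close>

lemma zemb_eq_0_iff [simp]: "zemb p = 0 \<longleftrightarrow> p = 0"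
proof -
  have "map_poly of_int p = (0 :: rat poly) \<longleftrightarrow> p = 0"
    by (simp add: poly_eq_iff coeff_map_poly)
  moreover have "pcompose r [:0, 0, 1:] = 0 \<longleftrightarrow> r = 0" for r :: "rat poly"
    by (rule pcompose_eq_0_iff) simp
  ultimately show ?thesis by (simp add: zemb_def)
qed

lemma zemb_eq_iff: "zemb p = zemb q \<longleftrightarrow> p = q"
  using zemb_eq_0_iff[of "p - q"] by (simp del: zemb_eq_0_iff)

lemma in_Zq_iff: "in_Zq f \<longleftrightarrow> (\<exists>p. f = zemb p)"
  by (simp add: in_Zq_def zemb_def)

lemma qq_power_neq_1:
  assumes "d > 0"
  shows "qq ^ d \<noteq> 1"
proof
  assume "qq ^ d = 1"
  then have "zemb (X ^ d) = zemb 1" by simp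
  then have "X ^ d = 1" unfolding zemb_eq_iff .
  then have "poly (X ^ d) 0 = 1" by simp
  with assms show False by (simp add: power_0_left)
qed

section \<open>Rewriting the coefficients\<close>

lemma of_nat_fract_neq_0: "n > 0 \<Longrightarrow> (of_nat n :: rat poly fract) \<noteq> 0"
  using zemb_eq_0_iff[of "of_nat n"] by (simp del: zemb_eq_0_iff)

text \<open>With \<open>M = m - s\<close> and \<open>l = s - k - i\<close> the numerator
  \<open>m - k + 1\<close> is \<open>Suc M + i + l\<close>, so \<open>Suc_mult_kcoeff\<close> clears
  every fraction.\<close>

lemma kpoly_eq:
  fixes q :: "rat poly fract"
  assumes "k \<le> s" "s \<le> m"
  shows "(\<Sum>i = 0..s - k. of_nat (m - k + 1) / of_nat (m - s + 1)
              * of_nat ((m - s + i) choose i) * of_nat ((m - k - i) choose (s - k - i))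
              * q ^ (s - k - i)) = kpoly q (m - s) (s - k)"
  unfolding kpoly_def
proof (rule sum.cong[OF refl])
  fix i assume i: "i \<in> {0..s - k}"
  define M l where "M = m - s" and "l = s - k - i"
  have eqs: "m - k + 1 = Suc M + i + l" "m - s + 1 = Suc M" "m - k - i = M + l"
    using assms i by (auto simp: M_def l_def)
  have "of_nat (Suc M) * (of_nat (kcoeff M i l) :: rat poly fract)
     = of_nat (Suc M + i + l) * (of_nat ((M + i) choose i) * of_nat ((M + l) choose l))"
    by (simp only: Suc_mult_kcoeff flip: of_nat_mult)
  moreover have "a / b * c * d = e" if "b * e = a * (c * d)" "b \<noteq> 0" for a b c d e :: "rat poly fract"
    using that by (simp add: field_simps)
  moreover have "(of_nat (Suc M) :: rat poly fract) \<noteq> 0" by (rule of_nat_fract_neq_0) simp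
  ultimately have "of_nat (Suc M + i + l) / of_nat (Suc M) * of_nat ((M + i) choose i) * of_nat ((M + l) choose l)
     = (of_nat (kcoeff M i l) :: rat poly fract)"
    by blast
  then show "of_nat (m - k + 1) / of_nat (m - s + 1)
              * of_nat ((m - s + i) choose i) * of_nat ((m - k - i) choose (s - k - i))
              * q ^ (s - k - i) = of_nat (kcoeff (m - s) i (s - k - i)) * q ^ (s - k - i)"
    unfolding eqs M_def[symmetric] l_def[symmetric] by simp
qed

lemma cst_of_int: "cst (of_int c) = of_int c"
proof -
  have "zemb [:c:] = cst (of_int c)"
    by (simp add: zemb_def cst_def map_poly_pCons)
  then show ?thesis using zemb_of_int[of c] by (simp add: of_int_poly)
qed

text \<open>By \<open>r <= m\<close> the upper index is a natural number, so \<open>gchoose\<close>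
  is the ordinary binomial coefficient; a negative lower index is the case
  \<open>k < 2 * r + 2\<close>.\<close>

lemma cst_binomZ_eq:
  assumes "r \<le> m"
  shows "cst (binomZ (2 * int m - 2 * int r) (int k)
                - binomZ (2 * int m - 2 * int r) (int k - 2 * int r - 2))
    = of_int (acoeff (2 * m - 2 * r) (2 * r + 2) k)"
proof -
  have N: "2 * int m - 2 * int r = int (2 * m - 2 * r)" using assms by simp
  have 1: "binomZ (int a) (int b) = of_int (int (a choose b))" for a b
    by (simp add: binomZ_def binomial_gbinomial)
  have 2: "binomZ (int (2 * m - 2 * r)) (int k - 2 * int r - 2)
    = of_int (if 2 * r + 2 \<le> k then int ((2 * m - 2 * r) choose (k - (2 * r + 2))) else 0)"
  proof (cases "2 * r + 2 \<le> k")
    case True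
    then have "int k - 2 * int r - 2 = int (k - (2 * r + 2))" by simp
    then show ?thesis using True by (simp only: 1) simp
  qed (simp add: binomZ_def)
  show ?thesis unfolding N 1 2 acoeff_def of_int_diff[symmetric] by (rule cst_of_int)
qed

lemma Pfun_eq_tcoeff:
  assumes "r \<le> m" "s \<le> m"
  shows "Pfun m s r = (\<Prod>j = 0..s. 1 - qq ^ (m + 1 - j)) / ((1 - qq) powi (3 * int s - 2 * int r))
     * tcoeff qq m (2 * m - 2 * r) (2 * r + 2) s"
  unfolding Pfun_def tcoeff_def using assms
  by (intro arg_cong2[where f = "(*)"] sum.cong refl) (simp_all only: cst_binomZ_eq kpoly_eq atLeastAtMost_iff)

section \<open>Integrality of the coefficients\<close>

lemma zemb_kpoly: "zemb (kpoly X M u) = kpoly qq M u"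
  by (simp add: kpoly_def del: mult_pCons_left mult_pCons_right)

text \<open>Each denominator \<open>1 - qq ^ (m + 1 - k)\<close> is the factor \<open>j = k\<close>
  of the product; cancelling it leaves a polynomial.\<close>

lemma tcoeff_numerator_in_Zq:
  "in_Zq ((\<Prod>j = 0..s. 1 - qq ^ (m + 1 - j)) * tcoeff qq m N R s)" if "s \<le> m"
proof -
  define Q where "Q = (\<Sum>k = 0..s. (-1) ^ (s - k) * (\<Prod>j\<in>{0..s} - {k}. 1 - X ^ (m + 1 - j))
      * of_int (acoeff N R k) * kpoly X (m - s) (s - k))"
  have "(\<Prod>j = 0..s. 1 - qq ^ (m + 1 - j)) * ((-1) ^ (s - k) / (1 - qq ^ (m + 1 - k)))
     = (-1) ^ (s - k) * (\<Prod>j\<in>{0..s} - {k}. 1 - qq ^ (m + 1 - j))" if k: "k \<in> {0..s}" for k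
  proof -
    have "qq ^ (m + 1 - k) \<noteq> 1"
      using k \<open>s \<le> m\<close> by (intro qq_power_neq_1) auto
    then show ?thesis using k by (simp add: prod.remove[of "{0..s}" k])
  qed
  then have "(\<Prod>j = 0..s. 1 - qq ^ (m + 1 - j)) * tcoeff qq m N R s = zemb Q"
    unfolding tcoeff_def Q_def sum_distrib_left zemb_sum
    by (intro sum.cong refl) (simp only: zemb_mult zemb_power zemb_uminus zemb_1 zemb_prod zemb_diff
        zemb_X zemb_of_int zemb_kpoly flip: mult.assoc)
  then show ?thesis by (auto simp: in_Zq_iff)
qed

lemma one_minus_X_power: "1 - X ^ n = (1 - X) * (\<Sum>i<n. X ^ i)"
  by (rule one_diff_power_eq)

text \<open>As $q \to 1$, $(1-q^n)(1-q^{n+1})$ behaves like $n(n+1)(1-q)^2$, whereas each summand of the power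
  sum vanishes to order $N+1$; multiplying by \<open>D\<close> clears the remaining denominators.\<close>

lemma tcoeff_numerator_dvd:
  assumes "even R" "N + R = 2 * m + 2" "s \<le> m"
    and Q: "zemb Q = (\<Prod>j = 0..s. 1 - qq ^ (m + 1 - j)) * tcoeff qq m N R s"
  shows "(1 - X) ^ (m + N + 2) dvd (1 - X) ^ (3 * (m - s) + 2) * Q"
proof -
  define B where "B n = (\<Sum>i<n. X ^ i)" for n
  have B: "1 - X ^ n = (1 - X) * B n" for n by (simp only: B_def one_minus_X_power)
  have B1: "poly (B n) 1 = int n" for n by (simp add: B_def poly_sum poly_power)
  have "\<forall>s. \<exists>Q. s \<le> m \<longrightarrow> (\<Prod>j = 0..s. 1 - qq ^ (m + 1 - j)) * tcoeff qq m N R s = zemb Q"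
    using tcoeff_numerator_in_Zq unfolding in_Zq_iff by meson
  then obtain Qs where Qs: "s \<le> m \<Longrightarrow> (\<Prod>j = 0..s. 1 - qq ^ (m + 1 - j)) * tcoeff qq m N R s = zemb (Qs s)" for s
    by metis
  \<comment> \<open>\<open>D\<close> is the product of all denominators, and \<open>C s\<close> is
    what its factors with \<open>j > s\<close> leave once each gives up one \<open>1 - X\<close>.
    The exponent in \<open>U s\<close> counts these \<open>m - s\<close> factors and the
    \<open>2 * (m + 1 - s)\<close> that stem from \<open>(1 - q^n)(1 - q^(n+1))\<close>.\<close>
  define D where "D = (\<Prod>j = 0..m. 1 - X ^ (m + 1 - j))"
  define C where "C s = (\<Prod>j = s + 1..m. B (m + 1 - j))" for s
  define U where "U s = (1 - X) ^ (3 * (m - s) + 2) * Qs s * C s" for s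
  define g where "g n s = (-1) ^ s * X ^ (s * Suc n) * (B (Suc n) * B (Suc n + 1)) ^ (m + 1 - s)" for n s
  have D: "D = (\<Prod>j = 0..s. 1 - X ^ (m + 1 - j)) * ((1 - X) ^ (m - s) * C s)" if "s \<le> m" for s
  proof -
    have "{0..m} = {0..s} \<union> {s + 1..m}" using that by auto
    then have "D = (\<Prod>j = 0..s. 1 - X ^ (m + 1 - j)) * (\<Prod>j = s + 1..m. 1 - X ^ (m + 1 - j))"
      unfolding D_def by (simp only:) (rule prod.union_disjoint; auto)
    also have "(\<Prod>j = s + 1..m. 1 - X ^ (m + 1 - j)) = (1 - X) ^ (m - s) * C s"
      unfolding B prod.distrib C_def by simp
    finally show ?thesis .
  qed
  have D0: "D = (1 - X) ^ (m + 1) * (\<Prod>j = 0..m. B (m + 1 - j))"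
    unfolding D_def B prod.distrib by simp
  have U: "zemb (g n s * U s) = zemb D * ((-1) ^ s * tcoeff qq m N R s
        * ((1 - qq ^ Suc n) * (1 - qq ^ (Suc n + 1))) ^ (m + 1 - s) * qq ^ (s * Suc n))" if "s \<le> m" for n s
  proof -
    have "3 * (m - s) + 2 = (m + 1 - s) + (m + 1 - s) + (m - s)" using that by simp
    then have "g n s * U s = (-1) ^ s * X ^ (s * Suc n)
        * ((1 - X ^ Suc n) * (1 - X ^ (Suc n + 1))) ^ (m + 1 - s) * ((1 - X) ^ (m - s) * C s) * Qs s"
      unfolding g_def U_def B by (simp only: power_add power_mult_distrib mult_ac)
    then have "zemb (g n s * U s) = (-1) ^ s * qq ^ (s * Suc n)
        * ((1 - qq ^ Suc n) * (1 - qq ^ (Suc n + 1))) ^ (m + 1 - s) * zemb ((1 - X) ^ (m - s) * C s)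
        * ((\<Prod>j = 0..s. 1 - qq ^ (m + 1 - j)) * tcoeff qq m N R s)"
      unfolding Qs[OF that] by (simp only: zemb_mult zemb_power zemb_uminus zemb_1 zemb_diff zemb_X)
    also have "\<dots> = ((\<Prod>j = 0..s. 1 - qq ^ (m + 1 - j)) * zemb ((1 - X) ^ (m - s) * C s))
        * ((-1) ^ s * tcoeff qq m N R s
        * ((1 - qq ^ Suc n) * (1 - qq ^ (Suc n + 1))) ^ (m + 1 - s) * qq ^ (s * Suc n))"
      by (simp only: mult_ac)
    also have "(\<Prod>j = 0..s. 1 - qq ^ (m + 1 - j)) * zemb ((1 - X) ^ (m - s) * C s) = zemb D"
      unfolding D[OF that] by (simp only: zemb_mult zemb_prod zemb_power zemb_1 zemb_diff zemb_X)
    finally show ?thesis .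
  qed
  have "(1 - X) ^ (m + N + 2) dvd (\<Sum>s = 0..m. g n s * U s)" for n
  proof -
    let ?S = "\<Sum>k = 1..Suc n. (1 - X ^ (R * k)) * (1 - X ^ k) ^ N * X ^ ((m + 1) * (Suc n - k))"
    have "zemb (\<Sum>s = 0..m. g n s * U s) = zemb D * (\<Sum>s = 0..m. (-1) ^ s * tcoeff qq m N R s
        * ((1 - qq ^ Suc n) * (1 - qq ^ (Suc n + 1))) ^ (m + 1 - s) * qq ^ (s * Suc n))"
      unfolding zemb_sum sum_distrib_left by (intro sum.cong refl U) simp
    also have "(\<Sum>s = 0..m. (-1) ^ s * tcoeff qq m N R s
        * ((1 - qq ^ Suc n) * (1 - qq ^ (Suc n + 1))) ^ (m + 1 - s) * qq ^ (s * Suc n)) = 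
      (\<Sum>k = 1..Suc n. (1 - qq ^ (R * k)) * (1 - qq ^ k) ^ N * qq ^ ((m + 1) * (Suc n - k)))"
      by (rule power_sum_eq_tcoeff_sum[OF assms(1,2) qq_power_neq_1, symmetric])
    also have "\<dots> = zemb ?S"
      by (simp only: zemb_sum zemb_mult zemb_power zemb_1 zemb_diff zemb_X)
    finally have "(\<Sum>s = 0..m. g n s * U s) = D * ?S"
      by (simp only: zemb_eq_iff flip: zemb_mult)
    \<comment> \<open>In each summand \<open>1 - X ^ (R * k)\<close> gives one factor and
      \<open>(1 - X ^ k) ^ N\<close> gives \<open>N\<close>; with the \<open>m + 1\<close> factors
      from \<open>D\<close> the total is \<open>m + N + 2\<close>.\<close>
    moreover have "(1 - X) * (1 - X) ^ N dvd ?S"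
      unfolding B power_mult_distrib
      by (intro dvd_sum dvd_mult2 mult_dvd_mono) simp_all
    moreover have "(1 - X) ^ (m + 1) dvd D" unfolding D0 by (rule dvd_triv_left)
    ultimately have "(1 - X) ^ (m + 1) * ((1 - X) * (1 - X) ^ N) dvd (\<Sum>s = 0..m. g n s * U s)"
      by (simp only: mult_dvd_mono)
    then show ?thesis by (simp only: power_Suc[symmetric] power_add[symmetric]) simp
  qed
  then have "(1 - X) ^ (m + N + 2) dvd U s"
  proof (rule vandermonde_dvd[where e = "\<lambda>s. (-1) ^ s" and c = "\<lambda>n. int (Suc n) * int (Suc n + 1)"])
    show "poly (g n s) 1 = (- 1) ^ s * (int (Suc n) * int (Suc n + 1)) ^ (m + 1 - s)" for n s
      by (simp only: g_def poly_mult poly_power B1) simp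
    show "inj (\<lambda>n. int (Suc n) * int (Suc n + 1))"
    proof (rule linorder_inj_onI)
      fix a b :: nat assume "a < b"
      then have "int (Suc a) * int (Suc a + 1) < int (Suc b) * int (Suc b + 1)"
        by (intro mult_strict_mono) auto
      then show "int (Suc a) * int (Suc a + 1) \<noteq> int (Suc b) * int (Suc b + 1)" by simp
    qed (rule linear)
  qed (use assms in simp_all)
  moreover have "Qs s = Q"
    using Q Qs[OF \<open>s \<le> m\<close>] zemb_eq_iff by metis
  \<comment> \<open>The value is a product of positive integers \<open>m + 1 - j\<close>, so
    \<open>C s\<close> can be cancelled.\<close>
  moreover have "poly (C s) 1 \<noteq> 0"
    by (simp add: C_def poly_prod B1)
  ultimately show ?thesis
    unfolding U_def by (metis one_minus_X_power_dvd_cancel)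
qed

text \<open>For \<open>N = 2m - 2r\<close> the count is exact:
  \<open>m + N + 2 = (3 (m-s) + 2) + (3s - 2r)\<close>, so cancellation leaves precisely the power
  of \<open>1 - q\<close> to be divided out. If \<open>3s < 2r\<close>, that power stands in the
  numerator and only polynomiality of \<open>Q\<close> is needed.\<close>

lemma Pfun_in_Zq:
  assumes "r \<le> m" "s \<le> m"
  shows "in_Zq (Pfun m s r)"
proof -
  let ?N = "2 * m - 2 * r" and ?R = "2 * r + 2"
  obtain Q where Q: "(\<Prod>j = 0..s. 1 - qq ^ (m + 1 - j)) * tcoeff qq m ?N ?R s = zemb Q"
    using tcoeff_numerator_in_Zq[OF assms(2)] unfolding in_Zq_iff by blast
  have P: "Pfun m s r = zemb Q / (1 - qq) powi (3 * int s - 2 * int r)"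
    unfolding Pfun_eq_tcoeff[OF assms] Q[symmetric] by simp
  show ?thesis
  proof (cases "2 * r \<le> 3 * s")
    case True
    have "(1 - X) ^ (m + ?N + 2) dvd (1 - X) ^ (3 * (m - s) + 2) * Q"
      using assms by (intro tcoeff_numerator_dvd[OF _ _ _ Q[symmetric]]) auto
    moreover have "m + ?N + 2 = (3 * (m - s) + 2) + (3 * s - 2 * r)"
      using True assms by simp
    ultimately have "(1 - X) ^ (3 * (m - s) + 2) * (1 - X) ^ (3 * s - 2 * r)
        dvd (1 - X) ^ (3 * (m - s) + 2) * Q"
      by (simp only: power_add)
    moreover have "(1 - X) ^ (3 * (m - s) + 2) \<noteq> 0" by (rule one_minus_X_power_neq_0)
    ultimately have "(1 - X) ^ (3 * s - 2 * r) dvd Q"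
      by (simp only: dvd_mult_cancel_left) simp
    then obtain p where "Q = (1 - X) ^ (3 * s - 2 * r) * p" by (rule dvdE)
    then have "zemb Q = (1 - qq) ^ (3 * s - 2 * r) * zemb p"
      by (simp only: zemb_mult zemb_power zemb_1 zemb_diff zemb_X)
    moreover have "3 * int s - 2 * int r = int (3 * s - 2 * r)" using True by simp
    moreover have "1 - qq \<noteq> 0" using qq_power_neq_1[of 1] by simp
    ultimately have "Pfun m s r = zemb p" unfolding P by (simp only: power_int_of_nat) simp
    then show ?thesis unfolding in_Zq_iff by blast
  next
    case False
    then have "3 * int s - 2 * int r = - int (2 * r - 3 * s)" by simp
    then have "Pfun m s r = zemb Q * (1 - qq) ^ (2 * r - 3 * s)"
      unfolding P by (simp only: power_int_minus power_int_of_nat divide_inverse inverse_inverse_eq)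
    also have "\<dots> = zemb (Q * (1 - X) ^ (2 * r - 3 * s))"
      by (simp only: zemb_mult zemb_power zemb_1 zemb_diff zemb_X)
    finally show ?thesis unfolding in_Zq_iff by blast
  qed
qed

section \<open>The identity for the power sum\<close>

lemma Sfun_eq_tcoeff_sum:
  assumes "r \<le> m"
  shows "Sfun (2 * m - 2 * r + 1) n r
    = (\<Sum>s = 0..m. (-1) ^ s * tcoeff qq m (2 * m - 2 * r) (2 * r + 2) s
        * ((1 - qq ^ n) * (1 - qq ^ (n + 1))) ^ (m + 1 - s) * qq ^ (s * n))
      / ((1 - qq ^ (2 * r + 2)) * (1 - qq) ^ (2 * m - 2 * r))"
proof -
  let ?N = "2 * m - 2 * r" and ?R = "2 * r + 2"
  have NR: "?N + ?R = 2 * m + 2" using assms by simp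
  \<comment> \<open>For this first index the exponent of \<open>qh\<close> is even, so only powers
    of \<open>qq\<close> occur.\<close>
  have e: "?N + 1 + 2 * r + 1 = 2 * (m + 1)" using assms by simp
  have "Sfun (?N + 1) n r = (\<Sum>k = 1..n. (1 - qq ^ (?R * k)) * (1 - qq ^ k) ^ ?N * qq ^ ((m + 1) * (n - k)))
      / ((1 - qq ^ ?R) * (1 - qq) ^ ?N)"
    unfolding Sfun_def sum_divide_distrib e
  proof (rule sum.cong[OF refl])
    fix k
    have "qh ^ (2 * (m + 1) * (n - k)) = qq ^ ((m + 1) * (n - k))"
      by (simp only: qq_def power_mult[symmetric] mult.assoc)
    then show "(1 - qq ^ (?R * k)) / (1 - qq ^ ?R) * ((1 - qq ^ k) / (1 - qq)) ^ (?N + 1 - 1)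
        * qh ^ (2 * (m + 1) * (n - k))
      = (1 - qq ^ (?R * k)) * (1 - qq ^ k) ^ ?N * qq ^ ((m + 1) * (n - k)) / ((1 - qq ^ ?R) * (1 - qq) ^ ?N)"
      by (simp add: power_divide)
  qed
  then show ?thesis
    by (subst power_sum_eq_tcoeff_sum[OF _ NR qq_power_neq_1, symmetric]) simp_all
qed

theorem theorem5p1:
  fixes m r n :: nat
  assumes "r \<le> m" and "n \<ge> 1"
  shows "(\<forall>s \<le> m. in_Zq (Pfun m s r)) \<and>
    Sfun (2 * m - 2 * r + 1) n r =
      (\<Sum>k = 0..m. (-1) ^ k * Pfun m k r
         * (1 - qq ^ n) ^ (m + 1 - k) * (1 - qq ^ (n + 1)) ^ (m + 1 - k) * qq ^ (k * n)
         / ((1 - qq ^ (2 * r + 2)) * (1 - qq) powi (2 * int m - 3 * int k)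
            * (\<Prod>i = 0..k. 1 - qq ^ (m + 1 - i))))"
proof (intro conjI allI impI)
  show "in_Zq (Pfun m s r)" if "s \<le> m" for s using assms(1) that by (rule Pfun_in_Zq)
  show "Sfun (2 * m - 2 * r + 1) n r =
      (\<Sum>k = 0..m. (-1) ^ k * Pfun m k r
         * (1 - qq ^ n) ^ (m + 1 - k) * (1 - qq ^ (n + 1)) ^ (m + 1 - k) * qq ^ (k * n)
         / ((1 - qq ^ (2 * r + 2)) * (1 - qq) powi (2 * int m - 3 * int k)
            * (\<Prod>i = 0..k. 1 - qq ^ (m + 1 - i))))"
    unfolding Sfun_eq_tcoeff_sum[OF assms(1)] sum_divide_distrib
  proof (rule sum.cong[OF refl])
    fix k assume k: "k \<in> {0..m}"
    define E F where "E = (1 - qq) powi (3 * int k - 2 * int r)"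
      and "F = (1 - qq) powi (2 * int m - 3 * int k)"
    define G where "G = (\<Prod>i = 0..k. 1 - qq ^ (m + 1 - i))"
    define t where "t = tcoeff qq m (2 * m - 2 * r) (2 * r + 2) k"
    have q1: "1 - qq \<noteq> 0" using qq_power_neq_1[of 1] by simp
    \<comment> \<open>Each exponent may be negative, but
      \<open>(3k - 2r) + (2m - 3k) = 2m - 2r\<close> is a natural number by
      \<open>r <= m\<close>.\<close>
    have "E * F = (1 - qq) powi int (2 * m - 2 * r)"
      unfolding E_def F_def using assms q1 by (subst power_int_add[symmetric]) (simp_all add: of_nat_diff)
    then have EF: "E * F = (1 - qq) ^ (2 * m - 2 * r)" by (simp only: power_int_of_nat)
    have "G \<noteq> 0" unfolding G_def using k qq_power_neq_1 by auto
    have "Pfun m k r = G / E * t"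
      using k unfolding G_def E_def t_def by (intro Pfun_eq_tcoeff assms) simp
    with \<open>G \<noteq> 0\<close> have "a * t * (b * c) * d / (z * (1 - qq) ^ (2 * m - 2 * r)) = a * Pfun m k r * b * c * d / (z * F * G)" for a b c d z
      unfolding EF[symmetric] by (simp add: mult_ac)
    from this[of "(-1) ^ k" "(1 - qq ^ n) ^ (m + 1 - k)" "(1 - qq ^ (n + 1)) ^ (m + 1 - k)" "qq ^ (k * n)"
        "1 - qq ^ (2 * r + 2)"]
    show "(-1) ^ k * tcoeff qq m (2 * m - 2 * r) (2 * r + 2) k
        * ((1 - qq ^ n) * (1 - qq ^ (n + 1))) ^ (m + 1 - k) * qq ^ (k * n)
      / ((1 - qq ^ (2 * r + 2)) * (1 - qq) ^ (2 * m - 2 * r))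
      = (-1) ^ k * Pfun m k r
         * (1 - qq ^ n) ^ (m + 1 - k) * (1 - qq ^ (n + 1)) ^ (m + 1 - k) * qq ^ (k * n)
         / ((1 - qq ^ (2 * r + 2)) * (1 - qq) powi (2 * int m - 3 * int k)
            * (\<Prod>i = 0..k. 1 - qq ^ (m + 1 - i)))"
      unfolding power_mult_distrib t_def F_def G_def .
  qed
qed

end
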